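(* Let $m\in\mathbb{Z}$ and $n=|4m-1|$. Then $$\sum_{k=0}^{n-1}\binom{2k}{k}m^k\equiv0\pmod n.$$ *)

theory Defs
  imports "HOL-Number_Theory.Cong"
begin

end

theory Submission
  imports Defs
begin

text \<open>Since \<open>n\<close> divides \<open>4 m - 1\<close>, it is coprime to 4 and \<open>m\<close> acts as \<open>1 / 4\<close> modulo \<open>n\<close>.
  The sum of \<open>(2 k choose k) / 4 ^ k\<close> over \<open>k < n\<close> has the closed form
  \<open>2 n (2 n choose n) / 4 ^ n\<close>, which exhibits the factor \<open>n\<close>.\<close>

text \<open>The absorption identity \<open>Suc_times_binomial\<close> is used twice, joined by the
  symmetry of row \<open>2 * n + 1\<close> about its two middle entries.\<close>

lemma central_binomial_Suc:
  "Suc n * ((2 * Suc n) choose Suc n) = 2 * (2 * n + 1) * ((2 * n) choose n)"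
proof -
  have "Suc n * (Suc (2 * n) choose n) = Suc n * (Suc (2 * n) choose Suc n)"
    using Suc_times_binomial_add[of n n] by (simp add: mult_2)
  also have "\<dots> = Suc (2 * n) * ((2 * n) choose n)"
    by (rule Suc_times_binomial)
  finally have "Suc n * (Suc (2 * n) choose n) = Suc (2 * n) * ((2 * n) choose n)" .
  moreover have "Suc n * (Suc (Suc (2 * n)) choose Suc n) = Suc (Suc (2 * n)) * (Suc (2 * n) choose n)"
    by (rule Suc_times_binomial)
  ultimately show ?thesis
    by (simp add: algebra_simps)
qed

text \<open>The closed form scaled by \<open>4 ^ n\<close>, which keeps every term a natural
  number.\<close>

lemma sum_central_binomial:
  "(\<Sum>k<n. ((2 * k) choose k) * 4 ^ (n - k)) = 2 * n * ((2 * n) choose n)"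
proof (induction n)
  case 0
  show ?case by simp
next
  case (Suc n)
  have "(\<Sum>k<n. ((2 * k) choose k) * 4 ^ (Suc n - k)) = 4 * (\<Sum>k<n. ((2 * k) choose k) * 4 ^ (n - k))"
    unfolding sum_distrib_left by (intro sum.cong) (auto simp: Suc_diff_le)
  \<comment> \<open>The new summand \<open>k = n\<close> contributes
    \<open>4 * ((2 * n) choose n)\<close>.\<close>
  then have "(\<Sum>k<Suc n. ((2 * k) choose k) * 4 ^ (Suc n - k)) = 4 * (2 * n + 1) * ((2 * n) choose n)"
    unfolding Suc.IH by (simp add: algebra_simps)
  also have "\<dots> = 2 * (Suc n * ((2 * Suc n) choose Suc n))"
    unfolding central_binomial_Suc by (simp add: algebra_simps)
  finally show ?case by (simp only: mult.assoc)
qed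

theorem corollary1p2:
  fixes m :: int and n :: nat
  assumes "n = nat \<bar>4 * m - 1\<bar>"
  shows "[(\<Sum>k<n. int ((2 * k) choose k) * m ^ k) = 0] (mod (int n))"
proof -
  have "int n dvd 4 * m - 1"
    using assms by simp
  then have inv4: "[4 * m = 1] (mod int n)"
    by (simp add: cong_iff_dvd_diff)
  \<comment> \<open>\<open>m\<close> is the witness that 4 is invertible.\<close>
  then have coprime: "coprime (4 ^ n) (int n)"
    using coprime_iff_invertible_int[of 4 "int n"] by auto
  \<comment> \<open>As \<open>k < n\<close>, \<open>4 ^ n\<close> splits as
    \<open>4 ^ (n - k) * 4 ^ k\<close>, and \<open>4 ^ k\<close> pairs with
    \<open>m ^ k\<close>.\<close>
  have "4 ^ n * (\<Sum>k<n. int ((2 * k) choose k) * m ^ k)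
      = (\<Sum>k<n. int ((2 * k) choose k) * 4 ^ (n - k) * (4 * m) ^ k)"
    unfolding sum_distrib_left
    by (intro sum.cong) (auto simp: power_mult_distrib simp flip: power_add)
  also have "[\<dots> = (\<Sum>k<n. int ((2 * k) choose k) * 4 ^ (n - k) * 1 ^ k)] (mod int n)"
    by (intro cong_sum cong_mult cong_refl cong_pow inv4)
  also have "(\<Sum>k<n. int ((2 * k) choose k) * 4 ^ (n - k) * 1 ^ k)
      = int (2 * n * ((2 * n) choose n))"
    by (simp flip: sum_central_binomial)
  also have "[\<dots> = 4 ^ n * 0] (mod int n)"
    by (simp add: cong_0_iff)
  finally show ?thesis
    using cong_mult_lcancel[OF coprime] by blast
qed

end
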